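(* Let $(\mathcal{Z},\mathfrak{Z})$ be a measurable space, $P$ a probability measure on it, $\mu$ a $\sigma$-finite measure on it with $P\ll\mu$ and $p=\mathrm{d}P/\mathrm{d}\mu$, and $\alpha>0$. Let $\ell:\mathcal{Z}\to(-\infty,\infty]$ be measurable, $\ell\in\mathcal{L}^1(P)$, and finite $\mu$-a.e. and bounded below $\mu$-a.e. Let $I$ be either $[0,\infty)$ or $(0,\infty)$, and let $\psi:I\to(-\infty,\infty]$ be proper, lower semicontinuous, strictly convex, and differentiable on $(0,\infty)$, with $\lim_{t\uparrow\infty}\psi'(t)=\infty$; write $\psi'_+(0)=\lim_{t\downarrow 0}\psi'(t)$. If $I=(0,\infty)$, assume also that $p>0$ $\mu$-a.e. and $\psi'_+(0)=-\infty$. If $I=[0,\infty)$, assume $\psi'_+(0)>-\infty$ and interpret $\psi'(p)$ as $\psi'_+(0)$ where $p=0$. For $\lambda\in\mathbb{R}$ and $\mu$-a.e. $z$ define $$q_\lambda(z)=\underset{t\in I}{\mathrm{arg\,min}}\{\alpha\psi(t)+(\ell(z)-\alpha\psi'(p(z))+\lambda)t\}.$$ Then $q_\lambda$ is (well defined and) measurable. Consider the reduced problem $$\inf_q\ \int_{\mathcal{Z}}\{\alpha\psi(q)+(\ell-\alpha\psi'(p))q\}\,\mathrm{d}\mu\qquad(\ast)$$ over measurable $q$ with $q(z)\in I$ $\mu$-a.e. and $\int_{\mathcal{Z}}q\,\mathrm{d}\mu=1$. If $\lambda^\star\in\mathbb{R}$ satisfies $\int_{\mathcal{Z}}q_{\lambda^\star}\,\mathrm{d}\mu=1$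 and the objective of $(\ast)$ is finite at $q_{\lambda^\star}$, then $q^\star=q_{\lambda^\star}$ is the unique (up to $\mu$-a.e. equality) minimizer of $(\ast)$. At points $z$ for which the scalar minimizer $q_\lambda(z)$ lies in $(0,\infty)$, $$q_\lambda(z)=(\psi')^{-1}\!\left(\psi'(p(z))-\frac{\ell(z)+\lambda}{\alpha}\right).$$ If $I=[0,\infty)$, then $$q_\lambda(z)=\begin{cases}0,&\psi'(p(z))-\dfrac{\ell(z)+\lambda}{\alpha}\le\psi'_+(0),\\[0.6em](\psi')^{-1}\!\left(\psi'(p(z))-\dfrac{\ell(z)+\lambda}{\alpha}\right),&\text{otherwise.}\end{cases}$$ If moreover the constant $\alpha\int_{\mathcal{Z}}\{\psi'(p)p-\psi(p)\}\,\mathrm{d}\mu$ is finite, then (for such $\lambda^\star$) the probability measure with $\mu$-density $q^\star$ is also the unique minimizer of the original objective $\int_{\mathcal{Z}}\ell\,\mathrm{d}Q+\alpha\,\mathsf{D}_\psi(Q\Vert P)$ over probability measures $Q\ll\mu$ whose density $q=\mathrm{d}Q/\mathrm{d}\mu$ takes values in $I$ $\mu$-a.e.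
   Context: For $Q\ll\mu$ with density $q=\mathrm{d}Q/\mathrm{d}\mu$, the separable Bregman divergence is $$\mathsf{D}_\psi(Q\Vert P)=\int_{\mathcal{Z}}\{\psi(q)-\psi(p)-\psi'(p)(q-p)\}\,\mathrm{d}\mu.$$ Integrals are extended integrals in $(-\infty,\infty]$, defined whenever the negative part of the integrand has finite integral. Functions are understood up to $\mu$-null sets (in particular the pointwise formulas are asserted at points where $\ell$ is finite). $(\psi')^{-1}$ is the inverse of the strictly increasing map $\psi':(0,\infty)\to(\psi'_+(0),\infty)$. *)

theory Defs
  imports "HOL-Probability.Probability_Measure"
begin

definition proper_on :: "real set \<Rightarrow> (real \<Rightarrow> ereal) \<Rightarrow> bool" where
  "proper_on I \<psi> \<longleftrightarrow> (\<forall>t\<in>I. \<psi> t \<noteq> - \<infinity>) \<and> (\<exists>t\<in>I. \<psi> t \<noteq> \<infinity>)"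

text \<open>Lower semicontinuity is relative to the domain \<open>I\<close>: no condition is imposed at an
  endpoint that does not belong to \<open>I\<close>.\<close>

definition lsc_on :: "real set \<Rightarrow> (real \<Rightarrow> ereal) \<Rightarrow> bool" where
  "lsc_on I \<psi> \<longleftrightarrow> (\<forall>t\<in>I. \<psi> t \<le> Liminf (at t within I) \<psi>)"

text \<open>As usual for extended-valued functions, the strict inequality is required on the
  effective domain.\<close>

definition strictly_convex_on :: "real set \<Rightarrow> (real \<Rightarrow> ereal) \<Rightarrow> bool" where
  "strictly_convex_on I \<psi> \<longleftrightarrow> convex I \<and>
     (\<forall>x\<in>I. \<forall>y\<in>I. \<forall>u\<in>{0<..<1::real}. x \<noteq> y \<longrightarrow> \<psi> x < \<infinity> \<longrightarrow> \<psi> y < \<infinity> \<longrightarrow>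
        \<psi> (u * x + (1 - u) * y) < ereal u * \<psi> x + ereal (1 - u) * \<psi> y)"

definition differentiable_pos :: "(real \<Rightarrow> ereal) \<Rightarrow> bool" where
  "differentiable_pos \<psi> \<longleftrightarrow>
     (\<forall>t>0. \<bar>\<psi> t\<bar> \<noteq> \<infinity> \<and> (\<lambda>s. real_of_ereal (\<psi> s)) differentiable (at t))"

definition psi_deriv0 :: "(real \<Rightarrow> ereal) \<Rightarrow> ereal" where
  "psi_deriv0 \<psi> = Lim (at_right 0) (\<lambda>t. ereal (deriv (\<lambda>s. real_of_ereal (\<psi> s)) t))"

text \<open>The derivative on \<open>(0,\<infinity>)\<close>, read as the right limit at \<open>0\<close>.  When that limit is
  \<open>-\<infinity>\<close>, or for negative arguments, the value is a mere convention; it will only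
  matter on null sets.\<close>

definition psi_deriv :: "(real \<Rightarrow> ereal) \<Rightarrow> real \<Rightarrow> real" where
  "psi_deriv \<psi> t =
     (if 0 < t then deriv (\<lambda>s. real_of_ereal (\<psi> s)) t else real_of_ereal (psi_deriv0 \<psi>))"

definition psi_deriv_inv :: "(real \<Rightarrow> ereal) \<Rightarrow> real \<Rightarrow> real" where
  "psi_deriv_inv \<psi> = the_inv_into {0<..} (psi_deriv \<psi>)"

text \<open>Extended integral in \<open>(-\<infinity>,\<infinity>]\<close>.  Since the integrands are only determined up to null
  sets, measurability is taken with respect to the completion; \<open>nn_integral\<close> does not
  depend on the values on null sets.\<close>

definition ext_integral :: "'a measure \<Rightarrow> ('a \<Rightarrow> ereal) \<Rightarrow> ereal" where
  "ext_integral M f =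
     enn2ereal (\<integral>\<^sup>+ z. e2ennreal (f z) \<partial>M) - enn2ereal (\<integral>\<^sup>+ z. e2ennreal (- f z) \<partial>M)"

definition ext_integral_defined :: "'a measure \<Rightarrow> ('a \<Rightarrow> ereal) \<Rightarrow> bool" where
  "ext_integral_defined M f \<longleftrightarrow>
     f \<in> borel_measurable (completion M) \<and> (\<integral>\<^sup>+ z. e2ennreal (- f z) \<partial>M) < \<infinity>"

definition ext_integral_finite :: "'a measure \<Rightarrow> ('a \<Rightarrow> ereal) \<Rightarrow> bool" where
  "ext_integral_finite M f \<longleftrightarrow> ext_integral_defined M f \<and> \<bar>ext_integral M f\<bar> \<noteq> \<infinity>"

definition scalar_obj ::
  "(real \<Rightarrow> ereal) \<Rightarrow> real \<Rightarrow> ('a \<Rightarrow> ereal) \<Rightarrow> ('a \<Rightarrow> real) \<Rightarrow> real \<Rightarrow> 'a \<Rightarrow> real \<Rightarrow> ereal" where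
  "scalar_obj \<psi> \<alpha> l p lam z t =
     ereal \<alpha> * \<psi> t + (l z - ereal (\<alpha> * psi_deriv \<psi> (p z)) + ereal lam) * ereal t"

definition q_dual ::
  "real set \<Rightarrow> (real \<Rightarrow> ereal) \<Rightarrow> real \<Rightarrow> ('a \<Rightarrow> ereal) \<Rightarrow> ('a \<Rightarrow> real) \<Rightarrow> real \<Rightarrow> 'a \<Rightarrow> real" where
  "q_dual I \<psi> \<alpha> l p lam z = arg_min_on (scalar_obj \<psi> \<alpha> l p lam z) I"

definition reduced_integrand ::
  "(real \<Rightarrow> ereal) \<Rightarrow> real \<Rightarrow> ('a \<Rightarrow> ereal) \<Rightarrow> ('a \<Rightarrow> real) \<Rightarrow> ('a \<Rightarrow> real) \<Rightarrow> 'a \<Rightarrow> ereal" where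
  "reduced_integrand \<psi> \<alpha> l p q z =
     ereal \<alpha> * \<psi> (q z) + (l z - ereal (\<alpha> * psi_deriv \<psi> (p z))) * ereal (q z)"

definition reduced_feasible :: "'a measure \<Rightarrow> real set \<Rightarrow> ('a \<Rightarrow> real) set" where
  "reduced_feasible M I =
     {q. q \<in> borel_measurable M \<and> (AE z in M. q z \<in> I) \<and> has_bochner_integral M q 1}"

definition reduced_obj ::
  "'a measure \<Rightarrow> (real \<Rightarrow> ereal) \<Rightarrow> real \<Rightarrow> ('a \<Rightarrow> ereal) \<Rightarrow> ('a \<Rightarrow> real) \<Rightarrow> ('a \<Rightarrow> real) \<Rightarrow> ereal" where
  "reduced_obj M \<psi> \<alpha> l p q = ext_integral M (reduced_integrand \<psi> \<alpha> l p q)"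

definition rn_dens :: "'a measure \<Rightarrow> 'a measure \<Rightarrow> 'a \<Rightarrow> real" where
  "rn_dens M Q z = enn2real (RN_deriv M Q z)"

definition bregman_integrand ::
  "(real \<Rightarrow> ereal) \<Rightarrow> ('a \<Rightarrow> real) \<Rightarrow> ('a \<Rightarrow> real) \<Rightarrow> 'a \<Rightarrow> ereal" where
  "bregman_integrand \<psi> q p z =
     \<psi> (q z) - \<psi> (p z) - ereal (psi_deriv \<psi> (p z) * (q z - p z))"

definition bregman_div ::
  "'a measure \<Rightarrow> (real \<Rightarrow> ereal) \<Rightarrow> 'a measure \<Rightarrow> 'a measure \<Rightarrow> ereal" where
  "bregman_div M \<psi> Q P = ext_integral M (bregman_integrand \<psi> (rn_dens M Q) (rn_dens M P))"

definition orig_feasible :: "'a measure \<Rightarrow> real set \<Rightarrow> 'a measure set" where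
  "orig_feasible M I =
     {Q. prob_space Q \<and> sets Q = sets M \<and> absolutely_continuous M Q \<and>
         (AE z in M. rn_dens M Q z \<in> I)}"

definition orig_obj ::
  "'a measure \<Rightarrow> (real \<Rightarrow> ereal) \<Rightarrow> real \<Rightarrow> ('a \<Rightarrow> ereal) \<Rightarrow> 'a measure \<Rightarrow> 'a measure \<Rightarrow> ereal" where
  "orig_obj M \<psi> \<alpha> l P Q = ext_integral Q l + ereal \<alpha> * bregman_div M \<psi> Q P"

end

theory Submission
  imports Defs
begin

text \<open>For each point \<open>z\<close> the scalar problem minimizes \<open>\<psi> t - y t\<close> over \<open>I\<close> with
  \<open>y = \<psi>'(p z) - (l z + \<lambda>) / \<alpha>\<close>; strict convexity makes its minimizer a monotone, hence
  measurable, function of \<open>y\<close>.  Adding \<open>\<lambda> (\<integral> q - 1)\<close>, which vanishes on feasible densities, to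
  the reduced objective turns its excess over the value at \<open>q\<^sub>\<lambda>\<close> into the integral of a
  nonnegative function that vanishes only where \<open>q = q\<^sub>\<lambda>\<close>.  The original objective differs
  from the reduced one by a finite constant.\<close>

subsection \<open>Extended integrals\<close>

text \<open>The objective may be infinite at a competitor, so an excess cannot be formed by
  subtracting integrals. Integrands are instead split pointwise into an integrable real part and a
  nonnegative measurable remainder; the extended integral is additive over such a split even if the
  remainder has infinite integral. In the reduced problem the integrable part comes from finiteness
  at the candidate. In the original problem the lower bound on \<open>l\<close> and nonnegativity of
  the Bregman integrand make the split possible. The other difficulty is the endpoint 0, where no
  derivative is given. If 0 lies in \<open>I\<close>, the finite right limit of the derivative,
  together with lower semicontinuity, supplies a supporting line there. If it does not, the limit is
  -\<infinity>, so no real slope pushes the minimizer to 0.\<close>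

lemma measurable_completion_AE_cong:
  assumes g: "g \<in> borel_measurable (completion M)" and eq: "AE z in completion M. f z = g z"
  shows "f \<in> borel_measurable (completion M)"
proof (rule measurableI)
  fix A :: "'b::topological_space set" assume "A \<in> sets borel"
  then have "g -` A \<inter> space (completion M) \<in> sets (completion M)"
    by (rule measurable_sets[OF g])
  with _ show "f -` A \<inter> space (completion M) \<in> sets (completion M)"
  proof (rule completion.in_sets_AE)
    show "AE z in completion M. z \<in> g -` A \<inter> space (completion M) \<longleftrightarrow> z \<in> f -` A \<inter> space (completion M)"
      using eq by (rule eventually_mono) simp
  qed simp
qed auto

lemma ext_integral_AE_eq_real:
  fixes w :: "'a \<Rightarrow> real"
  assumes "w \<in> borel_measurable M" "AE z in M. f z = ereal (w z)"
  shows "ext_integral M f = enn2ereal (\<integral>\<^sup>+ z. ennreal (w z) \<partial>M) - enn2ereal (\<integral>\<^sup>+ z. ennreal (- w z) \<partial>M)"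
    and "ext_integral_defined M f \<longleftrightarrow> (\<integral>\<^sup>+ z. ennreal (- w z) \<partial>M) < \<infinity>"
proof -
  have pos: "(\<integral>\<^sup>+ z. e2ennreal (f z) \<partial>M) = (\<integral>\<^sup>+ z. ennreal (w z) \<partial>M)"
    using assms(2) by (intro nn_integral_cong_AE) (auto elim!: eventually_mono)
  have neg: "(\<integral>\<^sup>+ z. e2ennreal (- f z) \<partial>M) = (\<integral>\<^sup>+ z. ennreal (- w z) \<partial>M)"
    using assms(2) by (intro nn_integral_cong_AE) (auto elim!: eventually_mono)
  show "ext_integral M f = enn2ereal (\<integral>\<^sup>+ z. ennreal (w z) \<partial>M) - enn2ereal (\<integral>\<^sup>+ z. ennreal (- w z) \<partial>M)"
    by (simp add: ext_integral_def pos neg)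
  have "(\<lambda>z. ereal (w z)) \<in> borel_measurable (completion M)"
    using assms(1) by (intro borel_measurable_ereal measurable_completion)
  then have "f \<in> borel_measurable (completion M)"
    using AE_completion[OF assms(2)] by (rule measurable_completion_AE_cong)
  then show "ext_integral_defined M f \<longleftrightarrow> (\<integral>\<^sup>+ z. ennreal (- w z) \<partial>M) < \<infinity>"
    by (simp add: ext_integral_defined_def neg)
qed

lemma ext_integral_eq_integral:
  fixes w :: "'a \<Rightarrow> real"
  assumes "integrable M w" "AE z in M. f z = ereal (w z)"
  shows "ext_integral M f = ereal (\<integral>z. w z \<partial>M)"
proof -
  have "(\<integral>\<^sup>+ z. ennreal (w z) \<partial>M) \<noteq> \<infinity>" "(\<integral>\<^sup>+ z. ennreal (- w z) \<partial>M) \<noteq> \<infinity>"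
    and w: "w \<in> borel_measurable M"
    using assms(1) by (auto simp: real_integrable_def)
  then obtain a b where "0 \<le> a" "(\<integral>\<^sup>+ z. ennreal (w z) \<partial>M) = ennreal a"
      "0 \<le> b" "(\<integral>\<^sup>+ z. ennreal (- w z) \<partial>M) = ennreal b"
    using that by (cases "\<integral>\<^sup>+ z. ennreal (w z) \<partial>M" rule: ennreal_cases;
        cases "\<integral>\<^sup>+ z. ennreal (- w z) \<partial>M" rule: ennreal_cases) auto
  then show ?thesis
    unfolding ext_integral_AE_eq_real(1)[OF w assms(2)] real_lebesgue_integral_def[OF assms(1)]
    by (simp add: enn2ereal_ennreal)
qed

lemma integrable_if_ext_integral_finite:
  fixes w :: "'a \<Rightarrow> real"
  assumes "w \<in> borel_measurable M" "AE z in M. f z = ereal (w z)" "ext_integral_finite M f"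
  shows "integrable M w"
proof -
  have fin: "(\<integral>\<^sup>+ z. ennreal (- w z) \<partial>M) < \<infinity>"
    using assms ext_integral_AE_eq_real(2)[OF assms(1,2)] by (simp add: ext_integral_finite_def)
  moreover have "(\<integral>\<^sup>+ z. ennreal (w z) \<partial>M) \<noteq> \<infinity>"
  proof
    assume "(\<integral>\<^sup>+ z. ennreal (w z) \<partial>M) = \<infinity>"
    then have "ext_integral M f = \<infinity>"
      using fin unfolding ext_integral_AE_eq_real(1)[OF assms(1,2)] by (simp add: ereal_minus_eq_PInfty_iff)
    then show False using assms(3) by (simp add: ext_integral_finite_def)
  qed
  ultimately show ?thesis using assms(1) by (simp add: real_integrable_def less_top[symmetric])
qed

text \<open>The negative part of \<open>u + v\<close> is dominated by that of \<open>u\<close>, so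
  the difference of the two nonnegative integrals is never \<infinity> - \<infinity>. This is the
  additivity used for all the extended integrals below.\<close>

lemma ext_integral_integrable_plus_nonneg:
  fixes u v :: "'a \<Rightarrow> real"
  assumes u: "integrable M u" and v [measurable]: "v \<in> borel_measurable M"
    and nonneg: "AE z in M. 0 \<le> v z"
    and f: "AE z in M. f z = ereal (u z + v z)"
  shows "ext_integral_defined M f"
    and "ext_integral M f = ereal (\<integral>z. u z \<partial>M) + enn2ereal (\<integral>\<^sup>+ z. ennreal (v z) \<partial>M)"
proof -
  have [measurable]: "u \<in> borel_measurable M" using u by auto
  have w [measurable]: "(\<lambda>z. u z + v z) \<in> borel_measurable M" by measurable
  have u_fin: "(\<integral>\<^sup>+ z. ennreal (- u z) \<partial>M) < \<infinity>"
    using u by (simp add: real_integrable_def less_top[symmetric])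
  have "(\<integral>\<^sup>+ z. ennreal (- (u z + v z)) \<partial>M) \<le> (\<integral>\<^sup>+ z. ennreal (- u z) \<partial>M)"
    using nonneg by (intro nn_integral_mono_AE) (auto elim!: eventually_mono intro!: ennreal_leI)
  then have neg_fin: "(\<integral>\<^sup>+ z. ennreal (- (u z + v z)) \<partial>M) < \<infinity>"
    using u_fin by (rule le_less_trans)
  show "ext_integral_defined M f"
    using neg_fin ext_integral_AE_eq_real(2)[OF w f] by simp
  show "ext_integral M f = ereal (\<integral>z. u z \<partial>M) + enn2ereal (\<integral>\<^sup>+ z. ennreal (v z) \<partial>M)"
  proof (cases "(\<integral>\<^sup>+ z. ennreal (v z) \<partial>M) = \<infinity>")
    case True
    \<comment> \<open>Since \<open>v = (u + v) - u\<close>, the positive part of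
      \<open>u + v\<close> and the negative part of \<open>u\<close> together dominate
      \<open>v\<close>. The latter has finite integral, so the former has to absorb the infinite
      mass.\<close>
    have "(\<integral>\<^sup>+ z. ennreal (v z) \<partial>M) \<le> (\<integral>\<^sup>+ z. ennreal (u z + v z) + ennreal (- u z) \<partial>M)"
      using nonneg
    proof (intro nn_integral_mono_AE, eventually_elim)
      case (elim z)
      show ?case
        using elim by (auto simp: ennreal_plus_if intro!: ennreal_leI)
    qed
    also have "\<dots> = (\<integral>\<^sup>+ z. ennreal (u z + v z) \<partial>M) + (\<integral>\<^sup>+ z. ennreal (- u z) \<partial>M)"
      by (intro nn_integral_add) auto
    finally have "(\<integral>\<^sup>+ z. ennreal (u z + v z) \<partial>M) = \<infinity>"
      using True u_fin by (auto simp: top_unique)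
    then show ?thesis
      using neg_fin True
      unfolding ext_integral_AE_eq_real(1)[OF w f] by (simp add: ereal_minus_eq_PInfty_iff)
  next
    case False
    then have "integrable M v"
      using nonneg by (intro integrableI_nonneg) (auto simp: less_top[symmetric])
    then have "ext_integral M f = ereal ((\<integral>z. u z \<partial>M) + (\<integral>z. v z \<partial>M))"
      using u by (subst ext_integral_eq_integral[OF _ f]) auto
    moreover have "(\<integral>\<^sup>+ z. ennreal (v z) \<partial>M) = ennreal (\<integral>z. v z \<partial>M)"
      using \<open>integrable M v\<close> nonneg by (rule nn_integral_eq_integral)
    ultimately show ?thesis
      using nonneg by (simp add: enn2ereal_ennreal integral_nonneg_AE)
  qed
qed

subsection \<open>The generator and its tangents\<close>

lemma strictly_convex_onD:
  assumes "strictly_convex_on I \<psi>" "x \<in> I" "y \<in> I" "0 < u" "u < 1" "x \<noteq> y" "\<psi> x < \<infinity>" "\<psi> y < \<infinity>"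
  shows "\<psi> (u * x + (1 - u) * y) < ereal u * \<psi> x + ereal (1 - u) * \<psi> y"
  using assms unfolding strictly_convex_on_def by simp

locale bregman_generator =
  fixes I :: "real set" and \<psi> :: "real \<Rightarrow> ereal"
  assumes I_cases: "I = {0..} \<or> I = {0<..}"
    and proper: "proper_on I \<psi>"
    and lsc: "lsc_on I \<psi>"
    and strictly_convex: "strictly_convex_on I \<psi>"
    and differentiable: "differentiable_pos \<psi>"
    and psi_deriv_at_top: "filterlim (psi_deriv \<psi>) at_top at_top"
    and psi_deriv0_open: "I = {0<..} \<Longrightarrow> psi_deriv0 \<psi> = - \<infinity>"
    and psi_deriv0_closed: "I = {0..} \<Longrightarrow> psi_deriv0 \<psi> > - \<infinity>"
begin

definition \<phi> :: "real \<Rightarrow> real" where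
  "\<phi> = (\<lambda>t. real_of_ereal (\<psi> t))"

lemma pos_in_I: "0 < t \<Longrightarrow> t \<in> I"
  using I_cases by auto

lemma in_I_nonneg: "t \<in> I \<Longrightarrow> 0 \<le> t"
  using I_cases by auto

lemma psi_eq_phi_pos: "0 < t \<Longrightarrow> \<psi> t = ereal (\<phi> t)"
  using differentiable unfolding differentiable_pos_def \<phi>_def by (auto simp: ereal_real)

lemma phi_strictly_convex_pos:
  assumes "0 < x" "0 < y" "0 < u" "u < 1" "x \<noteq> y"
  shows "\<phi> (u * x + (1 - u) * y) < u * \<phi> x + (1 - u) * \<phi> y"
proof -
  have fin: "\<psi> x = ereal (\<phi> x)" "\<psi> y = ereal (\<phi> y)"
    using assms psi_eq_phi_pos by auto
  have "\<psi> (u * x + (1 - u) * y) < ereal u * \<psi> x + ereal (1 - u) * \<psi> y"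
    using strictly_convex assms pos_in_I by (intro strictly_convex_onD) (auto simp: fin)
  moreover have "\<psi> (u * x + (1 - u) * y) = ereal (\<phi> (u * x + (1 - u) * y))"
    using assms by (intro psi_eq_phi_pos add_pos_pos mult_pos_pos) auto
  ultimately show ?thesis by (simp add: fin)
qed

lemma phi_has_derivative:
  "0 < t \<Longrightarrow> (\<phi> has_field_derivative psi_deriv \<psi> t) (at t)"
  using differentiable unfolding differentiable_pos_def psi_deriv_def \<phi>_def
  by (auto simp: real_differentiable_def DERIV_imp_deriv)

text \<open>Convexity and differentiability give only the weak tangent inequality. Using it at the
  midpoint of \<open>x\<close> and \<open>t\<close>, and strict convexity between \<open>x\<close>
  and \<open>t\<close>, makes it strict.\<close>

lemma phi_above_tangent_pos:
  assumes "0 < x" "0 < t" "t \<noteq> x"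
  shows "\<phi> x + psi_deriv \<psi> x * (t - x) < \<phi> t"
proof -
  have conv: "convex_on {0<..} \<phi>"
  proof (intro convex_onI)
    fix u x y :: real assume *: "0 < u" "u < 1" "x \<in> {0<..}" "y \<in> {0<..}"
    show "\<phi> ((1 - u) *\<^sub>R x + u *\<^sub>R y) \<le> (1 - u) * \<phi> x + u * \<phi> y"
    proof (cases "x = y")
      case True
      then show ?thesis by (simp add: algebra_simps)
    next
      case False
      then show ?thesis using phi_strictly_convex_pos[of x y "1 - u"] * by simp
    qed
  qed auto
  have tangent: "psi_deriv \<psi> x * (s - x) \<le> \<phi> s - \<phi> x" if "0 < s" for s
  proof (rule convex_on_imp_above_tangent[OF conv])
    show "(\<phi> has_field_derivative psi_deriv \<psi> x) (at x within {0<..})"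
      by (rule has_field_derivative_at_within[OF phi_has_derivative[OF assms(1)]])
  qed (use assms that in \<open>auto simp: interior_open\<close>)
  have "psi_deriv \<psi> x * ((1/2 * t + (1 - 1/2) * x) - x) \<le> \<phi> (1/2 * t + (1 - 1/2) * x) - \<phi> x"
    using assms by (intro tangent) auto
  moreover have "\<phi> (1/2 * t + (1 - 1/2) * x) < 1/2 * \<phi> t + (1 - 1/2) * \<phi> x"
    using assms by (intro phi_strictly_convex_pos) auto
  ultimately show ?thesis by (simp add: field_simps)
qed

lemma psi_deriv_strict_mono_pos:
  assumes "0 < x" "x < y"
  shows "psi_deriv \<psi> x < psi_deriv \<psi> y"
proof -
  have "\<phi> x + psi_deriv \<psi> x * (y - x) < \<phi> y" "\<phi> y + psi_deriv \<psi> y * (x - y) < \<phi> x"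
    using assms by (auto intro!: phi_above_tangent_pos)
  then have "psi_deriv \<psi> x * (y - x) < psi_deriv \<psi> y * (y - x)"
    by (simp add: algebra_simps)
  then show ?thesis using assms by simp
qed

text \<open>\<open>Lim\<close> carries information only once a limit is known to exist. Monotonicity
  of the derivative provides it and identifies it with the infimum, from which points with small
  derivative can be extracted.\<close>

lemma psi_deriv0_eq_INF: "psi_deriv0 \<psi> = (INF t\<in>{0<..}. ereal (psi_deriv \<psi> t))"
proof -
  let ?L = "INF t\<in>{0<..}. ereal (psi_deriv \<psi> t)"
  have ev: "\<forall>\<^sub>F t in at_right 0. (0::real) < t"
    by (simp add: eventually_at_right_less)
  have "((\<lambda>t. ereal (psi_deriv \<psi> t)) \<longlongrightarrow> ?L) (at_right 0)"
  proof (rule order_tendstoI)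
    fix a assume "a < ?L"
    show "\<forall>\<^sub>F t in at_right 0. a < ereal (psi_deriv \<psi> t)"
      using ev by (rule eventually_mono) (use \<open>a < ?L\<close> in \<open>auto intro: less_le_trans INF_lower\<close>)
  next
    fix a assume "?L < a"
    then obtain t0 where "0 < t0" "ereal (psi_deriv \<psi> t0) < a"
      by (auto simp: INF_less_iff)
    from \<open>0 < t0\<close> have "\<forall>\<^sub>F t in at_right 0. t < t0"
      using eventually_at_right_real[of 0 t0] by (auto elim: eventually_mono)
    moreover note ev
    ultimately show "\<forall>\<^sub>F t in at_right 0. ereal (psi_deriv \<psi> t) < a"
      by eventually_elim
        (meson \<open>ereal (psi_deriv \<psi> t0) < a\<close> less_ereal.simps(1) less_trans psi_deriv_strict_mono_pos)
  qed
  moreover have "\<forall>\<^sub>F t in at_right 0. ereal (psi_deriv \<psi> t) = ereal (deriv \<phi> t)"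
    using ev by eventually_elim (simp add: psi_deriv_def \<phi>_def)
  ultimately have "((\<lambda>t. ereal (deriv \<phi> t)) \<longlongrightarrow> ?L) (at_right 0)"
    by (rule Lim_transform_eventually)
  then show ?thesis
    unfolding psi_deriv0_def \<phi>_def by (intro tendsto_Lim) (auto simp: trivial_limit_at_right_real)
qed

lemma psi_deriv0_less:
  assumes "0 < t"
  shows "psi_deriv0 \<psi> < ereal (psi_deriv \<psi> t)"
proof -
  have "psi_deriv0 \<psi> \<le> ereal (psi_deriv \<psi> (t / 2))"
    unfolding psi_deriv0_eq_INF using assms by (intro INF_lower) auto
  also have "\<dots> < ereal (psi_deriv \<psi> t)"
    using assms psi_deriv_strict_mono_pos[of "t / 2" t] by simp
  finally show ?thesis .
qed

text \<open>Surjectivity is Darboux's argument, which needs no continuity of the derivative: between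
  points where the derivative lies below and above \<open>y\<close>, the function \<phi> t - y t has
  a minimum on a compact interval. The signs of its derivative at the ends exclude the ends, and at
  an interior minimum the derivative of \<phi> equals \<open>y\<close>.\<close>

lemma bij_psi_deriv: "bij_betw (psi_deriv \<psi>) {0<..} {y. psi_deriv0 \<psi> < ereal y}"
proof (rule bij_betw_imageI)
  have "strict_mono_on {0<..} (psi_deriv \<psi>)"
    by (auto intro!: strict_mono_onI psi_deriv_strict_mono_pos)
  then show "inj_on (psi_deriv \<psi>) {0<..}"
    by (rule strict_mono_on_imp_inj_on)
  have "y \<in> psi_deriv \<psi> ` {0<..}" if y: "psi_deriv0 \<psi> < ereal y" for y
  proof -
    from y obtain a where a: "0 < a" "psi_deriv \<psi> a < y"
      unfolding psi_deriv0_eq_INF by (auto simp: INF_less_iff)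
    have "\<forall>\<^sub>F t in at_top. y < psi_deriv \<psi> t \<and> a < t"
      using psi_deriv_at_top
      by (intro eventually_conj eventually_gt_at_top) (simp add: filterlim_at_top_dense)
    then obtain b where b: "y < psi_deriv \<psi> b" "a < b"
      by (auto simp: eventually_at_top_linorder)
    let ?g = "\<lambda>t. \<phi> t - y * t"
    have der: "(?g has_field_derivative psi_deriv \<psi> t - y) (at t)" if "0 < t" for t
      using that by (auto intro!: derivative_eq_intros phi_has_derivative)
    have "continuous_on {a..b} ?g"
      using a by (intro DERIV_continuous_on[of _ _ "\<lambda>t. psi_deriv \<psi> t - y"])
        (auto intro!: has_field_derivative_at_within[OF der])
    then obtain m where m: "m \<in> {a..b}" "\<forall>t\<in>{a..b}. ?g m \<le> ?g t"
      using b continuous_attains_inf[of "{a..b}" ?g] by auto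
    have "m \<noteq> a"
    proof
      assume "m = a"
      \<comment> \<open>The increment \<open>min (d / 2) (b - a)\<close> is small enough for the
        local decrease and keeps the point inside the interval.\<close>
      obtain d where "0 < d" "\<forall>h>0. h < d \<longrightarrow> ?g (a + h) < ?g a"
        using DERIV_neg_dec_right[OF der[OF a(1)]] a by auto
      then have "?g (a + min (d / 2) (b - a)) < ?g a"
        using b by auto
      moreover have "a + min (d / 2) (b - a) \<in> {a..b}"
        using b \<open>0 < d\<close> by auto
      ultimately show False using m(2) \<open>m = a\<close> by (metis not_le)
    qed
    moreover have "m \<noteq> b"
    proof
      assume "m = b"
      obtain d where "0 < d" "\<forall>h>0. h < d \<longrightarrow> ?g (b - h) < ?g b"
        using DERIV_pos_inc_left[OF der[of b]] a b by auto
      then have "?g (b - min (d / 2) (b - a)) < ?g b"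
        using b by auto
      moreover have "b - min (d / 2) (b - a) \<in> {a..b}"
        using b \<open>0 < d\<close> by auto
      ultimately show False using m(2) \<open>m = b\<close> by (metis not_le)
    qed
    ultimately have "a < m" "m < b" using m by auto
    then have "psi_deriv \<psi> m - y = 0"
      using a m by (intro DERIV_local_min[of ?g _ m "min (m - a) (b - m)"] der) (auto simp: abs_less_iff)
    then show ?thesis using a \<open>a < m\<close> by (intro image_eqI[of _ _ m]) auto
  qed
  then show "psi_deriv \<psi> ` {0<..} = {y. psi_deriv0 \<psi> < ereal y}"
    using psi_deriv0_less by auto
qed

lemma psi_deriv_inv_pos:
  assumes "psi_deriv0 \<psi> < ereal y"
  shows "0 < psi_deriv_inv \<psi> y" "psi_deriv \<psi> (psi_deriv_inv \<psi> y) = y"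
proof -
  have inj: "inj_on (psi_deriv \<psi>) {0<..}" and img: "y \<in> psi_deriv \<psi> ` {0<..}"
    using bij_psi_deriv assms by (auto simp: bij_betw_def)
  show "0 < psi_deriv_inv \<psi> y"
    using the_inv_into_into[OF inj img subset_refl] by (simp add: psi_deriv_inv_def)
  show "psi_deriv \<psi> (psi_deriv_inv \<psi> y) = y"
    using f_the_inv_into_f[OF inj img] by (simp add: psi_deriv_inv_def)
qed

lemma psi_deriv_inv_psi_deriv: "0 < t \<Longrightarrow> psi_deriv_inv \<psi> (psi_deriv \<psi> t) = t"
  using bij_psi_deriv unfolding psi_deriv_inv_def
  by (intro the_inv_into_f_f) (auto simp: bij_betw_def)

text \<open>Rules out the default value of \<open>real_of_ereal\<close>: the limit lies below the
  derivative at 1, and for closed \<open>I\<close> it is not -\<infinity>.\<close>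

lemma ereal_psi_deriv_at_0:
  assumes "0 \<in> I"
  shows "ereal (psi_deriv \<psi> 0) = psi_deriv0 \<psi>"
proof -
  have "psi_deriv0 \<psi> \<noteq> \<infinity>" using psi_deriv0_less[of 1] by auto
  moreover have "psi_deriv0 \<psi> \<noteq> - \<infinity>" using assms I_cases psi_deriv0_closed by auto
  ultimately show ?thesis by (cases "psi_deriv0 \<psi>") (auto simp: psi_deriv_def)
qed

text \<open>Tangent lines at \<open>s \<down> 0\<close> bound \<open>\<psi> s\<close> from above by values tending to
  \<open>\<psi> t - \<psi>'(0) t\<close>; lower semicontinuity carries this bound to \<open>\<psi> 0\<close>.\<close>

lemma psi_0_le:
  assumes "0 \<in> I" "0 < t"
  shows "\<psi> 0 \<le> ereal (\<phi> t - psi_deriv \<psi> 0 * t)"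
proof -
  have "I = {0..}" using assms I_cases by auto
  let ?f = "\<lambda>s. ereal (\<phi> t - psi_deriv \<psi> 0 * (t - s))"
  have le: "\<psi> s \<le> ?f s" if "0 < s" "s < t" for s
  proof -
    have "psi_deriv \<psi> 0 < psi_deriv \<psi> s"
      using psi_deriv0_less[OF \<open>0 < s\<close>] ereal_psi_deriv_at_0[OF assms(1)]
      by (metis less_ereal.simps(1))
    then have "psi_deriv \<psi> 0 * (t - s) \<le> psi_deriv \<psi> s * (t - s)"
      using that by (intro mult_right_mono) auto
    with phi_above_tangent_pos[of s t] that have "\<phi> s \<le> \<phi> t - psi_deriv \<psi> 0 * (t - s)"
      by linarith
    then have "ereal (\<phi> s) \<le> ?f s" by simp
    then show ?thesis using psi_eq_phi_pos[OF that(1)] by simp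
  qed
  have "\<psi> 0 \<le> Liminf (at 0 within I) \<psi>"
    using lsc assms unfolding lsc_on_def by auto
  also have "at 0 within I = at_right (0::real)"
    unfolding \<open>I = {0..}\<close> by (simp add: at_within_Ici_at_right)
  also have "Liminf (at_right 0) \<psi> \<le> Liminf (at_right 0) ?f"
  proof (rule Liminf_mono)
    show "\<forall>\<^sub>F s in at_right 0. \<psi> s \<le> ?f s"
      using eventually_at_right_real[OF assms(2)] by eventually_elim (auto intro: le)
  qed
  also have "(?f \<longlongrightarrow> ereal (\<phi> t - psi_deriv \<psi> 0 * (t - 0))) (at_right 0)"
    by (intro tendsto_intros)
  then have "Liminf (at_right 0) ?f = ereal (\<phi> t - psi_deriv \<psi> 0 * (t - 0))"
    by (intro lim_imp_Liminf) (auto simp: trivial_limit_at_right_real)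
  finally show ?thesis by simp
qed

text \<open>Only 0 could carry an infinite value. Properness excludes -\<infinity> there, and the
  upper bound obtained from tangents excludes \<infinity>.\<close>

lemma psi_eq_phi:
  assumes "t \<in> I"
  shows "\<psi> t = ereal (\<phi> t)"
proof (cases "0 < t")
  case True
  then show ?thesis by (rule psi_eq_phi_pos)
next
  case False
  then have "t = 0" "0 \<in> I" using assms in_I_nonneg[of t] by auto
  moreover have "\<psi> 0 \<noteq> - \<infinity>" using proper \<open>0 \<in> I\<close> unfolding proper_on_def by auto
  moreover have "\<psi> 0 \<noteq> \<infinity>" using psi_0_le[OF \<open>0 \<in> I\<close>, of 1] by auto
  ultimately show ?thesis using \<open>t = 0\<close> by (cases "\<psi> 0") (auto simp: \<phi>_def)
qed

text \<open>The midpoint device again, with the bound from lower semicontinuity at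
  \<open>t / 2\<close> in place of a tangent inequality.\<close>

lemma phi_above_tangent_0:
  assumes "0 \<in> I" "0 < t"
  shows "\<phi> 0 + psi_deriv \<psi> 0 * t < \<phi> t"
proof -
  have fin: "\<psi> t = ereal (\<phi> t)" "\<psi> 0 = ereal (\<phi> 0)" "\<psi> (t / 2) = ereal (\<phi> (t / 2))"
    using assms psi_eq_phi pos_in_I by auto
  have "ereal (\<phi> 0) \<le> ereal (\<phi> (t / 2) - psi_deriv \<psi> 0 * (t / 2))"
    using psi_0_le[of "t / 2"] assms fin by simp
  moreover have "\<psi> (1/2 * t + (1 - 1/2) * 0) < ereal (1/2) * \<psi> t + ereal (1 - 1/2) * \<psi> 0"
    using strictly_convex assms pos_in_I[of t] by (intro strictly_convex_onD) (auto simp: fin)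
  ultimately show ?thesis by (simp add: fin field_simps)
qed

text \<open>The minimizer of \<open>\<psi> t - y t\<close> over \<open>I\<close>, that is, the derivative of the convex
  conjugate of \<open>\<psi>\<close> at \<open>y\<close>.\<close>

definition conj_deriv :: "real \<Rightarrow> real" where
  "conj_deriv y = (if ereal y \<le> psi_deriv0 \<psi> then 0 else psi_deriv_inv \<psi> y)"

text \<open>For open \<open>I\<close> no real number is at most -\<infinity>, so the value 0 of
  \<open>conj_deriv\<close> is taken only when 0 is admissible.\<close>

lemma le_psi_deriv0_imp_0_in_I: "ereal y \<le> psi_deriv0 \<psi> \<Longrightarrow> 0 \<in> I"
  using I_cases psi_deriv0_open by auto

lemma conj_deriv_in_I: "conj_deriv y \<in> I"
  using psi_deriv_inv_pos(1)[of y] le_psi_deriv0_imp_0_in_I[of y]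
  by (auto simp: conj_deriv_def not_le intro: pos_in_I)

lemma mono_conj_deriv: "mono conj_deriv"
proof (rule monoI)
  fix x y :: real assume "x \<le> y"
  show "conj_deriv x \<le> conj_deriv y"
  proof (cases "ereal x \<le> psi_deriv0 \<psi>")
    case True
    then show ?thesis
      using in_I_nonneg[OF conj_deriv_in_I] by (simp add: conj_deriv_def[of x])
  next
    case False
    then have x: "psi_deriv0 \<psi> < ereal x" by simp
    also have "\<dots> \<le> ereal y" using \<open>x \<le> y\<close> by simp
    finally have y: "psi_deriv0 \<psi> < ereal y" .
    have "psi_deriv_inv \<psi> x \<le> psi_deriv_inv \<psi> y"
      using psi_deriv_strict_mono_pos[of "psi_deriv_inv \<psi> y" "psi_deriv_inv \<psi> x"]
        psi_deriv_inv_pos[OF x] psi_deriv_inv_pos[OF y] \<open>x \<le> y\<close> by fastforce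
    then show ?thesis using x y by (auto simp: conj_deriv_def)
  qed
qed

lemma borel_measurable_conj_deriv [measurable]: "conj_deriv \<in> borel_measurable borel"
  by (rule borel_measurable_mono[OF mono_conj_deriv])

lemma conj_deriv_psi_deriv:
  assumes "t \<in> I"
  shows "conj_deriv (psi_deriv \<psi> t) = t"
proof (cases "0 < t")
  case True
  then show ?thesis
    using psi_deriv0_less[OF True] psi_deriv_inv_psi_deriv[OF True] by (simp add: conj_deriv_def)
next
  case False
  then have "t = 0" "0 \<in> I" using assms in_I_nonneg[of t] by auto
  then show ?thesis using ereal_psi_deriv_at_0 by (simp add: conj_deriv_def)
qed

text \<open>For \<open>y\<close> at most the right limit of the derivative at 0, the supporting line
  at 0 is at least as steep as \<open>y\<close>, so moving right only increases the objective. For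
  larger \<open>y\<close>, the first-order condition makes the line of slope \<open>y\<close>
  tangent at the minimizer.\<close>

lemma conj_deriv_strict_min:
  assumes "t \<in> I" "t \<noteq> conj_deriv y"
  shows "\<phi> (conj_deriv y) - y * conj_deriv y < \<phi> t - y * t"
proof (cases "ereal y \<le> psi_deriv0 \<psi>")
  case True
  then have "0 \<in> I" by (rule le_psi_deriv0_imp_0_in_I)
  with True have "y \<le> psi_deriv \<psi> 0" by (simp add: ereal_psi_deriv_at_0[symmetric])
  have "conj_deriv y = 0" using True by (simp add: conj_deriv_def)
  moreover have "0 < t" using assms calculation in_I_nonneg[of t] by auto
  moreover have "y * t \<le> psi_deriv \<psi> 0 * t"
    using \<open>y \<le> psi_deriv \<psi> 0\<close> \<open>0 < t\<close> by simp
  moreover have "\<phi> 0 + psi_deriv \<psi> 0 * t < \<phi> t"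
    using phi_above_tangent_0[OF \<open>0 \<in> I\<close> \<open>0 < t\<close>] .
  ultimately have "\<phi> 0 < \<phi> t - y * t" by linarith
  then show ?thesis using \<open>conj_deriv y = 0\<close> by simp
next
  case False
  let ?x = "conj_deriv y"
  have x: "0 < ?x" "psi_deriv \<psi> ?x = y"
    using False psi_deriv_inv_pos[of y] by (auto simp: conj_deriv_def)
  have "\<phi> ?x + y * (t - ?x) < \<phi> t"
  proof (cases "0 < t")
    case True
    then show ?thesis using phi_above_tangent_pos[OF x(1) True] assms x by simp
  next
    case False
    then have "t = 0" "0 \<in> I" using assms in_I_nonneg[of t] by auto
    text \<open>At \<open>t = 0\<close>, convexity moves the strict tangent inequality from \<open>?x / 2\<close> to \<open>0\<close>.\<close>
    have fin: "\<psi> ?x = ereal (\<phi> ?x)" "\<psi> 0 = ereal (\<phi> 0)" "\<psi> (?x / 2) = ereal (\<phi> (?x / 2))"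
      using x \<open>0 \<in> I\<close> psi_eq_phi pos_in_I by auto
    have "\<psi> (1/2 * ?x + (1 - 1/2) * 0) < ereal (1/2) * \<psi> ?x + ereal (1 - 1/2) * \<psi> 0"
      using strictly_convex \<open>0 \<in> I\<close> x pos_in_I[of ?x] by (intro strictly_convex_onD) (auto simp: fin)
    moreover have "\<phi> ?x + y * (?x / 2 - ?x) < \<phi> (?x / 2)"
      using phi_above_tangent_pos[of ?x "?x / 2"] x by simp
    ultimately show ?thesis using \<open>t = 0\<close> by (simp add: fin field_simps)
  qed
  then show ?thesis by (simp add: algebra_simps)
qed

lemma conj_deriv_min:
  assumes "t \<in> I"
  shows "\<phi> (conj_deriv y) - y * conj_deriv y \<le> \<phi> t - y * t"
  using conj_deriv_strict_min[OF assms, of y] by (cases "t = conj_deriv y") auto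

text \<open>The Bregman expression is the excess of \<phi> t - y t over its minimum for
  \<open>y = psi_deriv \<psi> s\<close>, attained at \<open>s\<close>. This treats
  \<open>s = 0\<close> together with \<open>s > 0\<close>.\<close>

lemma bregman_nonneg:
  assumes "s \<in> I" "t \<in> I"
  shows "0 \<le> \<phi> t - \<phi> s - psi_deriv \<psi> s * (t - s)"
  using conj_deriv_min[OF assms(2), of "psi_deriv \<psi> s"] conj_deriv_psi_deriv[OF assms(1)]
  by (simp add: algebra_simps)

text \<open>On \<open>I\<close> the maximum with \<open>0\<close> has no effect; it discards the arbitrary values of
  \<open>\<psi>\<close> on the negative numbers.\<close>

lemma borel_measurable_phi_max [measurable]: "(\<lambda>t. \<phi> (max 0 t)) \<in> borel_measurable borel"
proof -
  have "continuous_on {0<..} \<phi>"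
    using phi_has_derivative by (intro DERIV_continuous_on[of _ _ "psi_deriv \<psi>"])
      (auto intro: has_field_derivative_at_within)
  then have "(\<lambda>t. if t \<in> {0<..} then \<phi> t else \<phi> 0) \<in> borel_measurable borel"
    by (intro borel_measurable_continuous_on_if) auto
  also have "(\<lambda>t. if t \<in> {0<..} then \<phi> t else \<phi> 0) = (\<lambda>t. \<phi> (max 0 t))"
    by (auto simp: max_def fun_eq_iff)
  finally show ?thesis .
qed

lemma borel_measurable_psi_deriv [measurable]: "psi_deriv \<psi> \<in> borel_measurable borel"
proof -
  have "mono_on {0<..} (psi_deriv \<psi>)"
    using psi_deriv_strict_mono_pos by (intro mono_onI) (metis greaterThan_iff order.order_iff_strict)
  then have "psi_deriv \<psi> \<in> borel_measurable (restrict_space borel {0<..})"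
    by (rule borel_measurable_mono_on_fnc)
  then have "(\<lambda>t. if t \<in> {0<..} then psi_deriv \<psi> t else real_of_ereal (psi_deriv0 \<psi>))
      \<in> borel_measurable borel"
    by (intro measurable_If_restrict_space_iff[THEN iffD2]) (auto simp: greaterThan_def)
  also have "(\<lambda>t. if t \<in> {0<..} then psi_deriv \<psi> t else real_of_ereal (psi_deriv0 \<psi>)) = psi_deriv \<psi>"
    by (auto simp: psi_deriv_def fun_eq_iff)
  finally show ?thesis .
qed

end

subsection \<open>The dual form of the minimizer\<close>

locale bregman_problem = bregman_generator I \<psi> + sigma_finite_measure M
  for I :: "real set" and \<psi> :: "real \<Rightarrow> ereal" and M :: "'a measure" +
  fixes p :: "'a \<Rightarrow> real" and \<alpha> :: real and l :: "'a \<Rightarrow> ereal" and b :: real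
  assumes p_measurable [measurable]: "p \<in> borel_measurable M"
    and p_in_I: "AE z in M. p z \<in> I"
    and alpha_pos: "0 < \<alpha>"
    and l_measurable [measurable]: "l \<in> borel_measurable M"
    and l_not_MInfty: "z \<in> space M \<Longrightarrow> l z \<noteq> - \<infinity>"
    and l_finite: "AE z in M. l z \<noteq> \<infinity>"
    and l_bounded_below: "AE z in M. ereal b \<le> l z"
begin

definition L :: "'a \<Rightarrow> real" where
  "L z = real_of_ereal (l z)"

definition slope :: "real \<Rightarrow> 'a \<Rightarrow> real" where
  "slope lam z = psi_deriv \<psi> (p z) - (L z + lam) / \<alpha>"

lemma L_measurable [measurable]: "L \<in> borel_measurable M"
  unfolding L_def by measurable

lemma slope_measurable [measurable]: "slope lam \<in> borel_measurable M"
  unfolding slope_def by measurable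

lemma l_eq_L: "z \<in> space M \<Longrightarrow> l z \<noteq> \<infinity> \<Longrightarrow> l z = ereal (L z)"
  using l_not_MInfty[of z] by (cases "l z") (auto simp: L_def)

lemma AE_l_eq_L: "AE z in M. l z = ereal (L z)"
  using l_finite AE_space by eventually_elim (rule l_eq_L)

lemma AE_L_ge: "AE z in M. b \<le> L z"
  using AE_l_eq_L l_bounded_below by eventually_elim simp

lemma scalar_obj_eq:
  assumes "z \<in> space M" "l z \<noteq> \<infinity>" "t \<in> I"
  shows "scalar_obj \<psi> \<alpha> l p lam z t = ereal (\<alpha> * (\<phi> t - slope lam z * t))"
  using alpha_pos unfolding scalar_obj_def slope_def l_eq_L[OF assms(1,2)] psi_eq_phi[OF assms(3)]
  by (simp add: field_simps)

lemma is_arg_min_scalar_obj_iff: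
  assumes "z \<in> space M" "l z \<noteq> \<infinity>"
  shows "is_arg_min (scalar_obj \<psi> \<alpha> l p lam z) (\<lambda>t. t \<in> I) t \<longleftrightarrow> t = conj_deriv (slope lam z)"
proof
  assume min: "is_arg_min (scalar_obj \<psi> \<alpha> l p lam z) (\<lambda>t. t \<in> I) t"
  show "t = conj_deriv (slope lam z)"
  proof (rule ccontr)
    assume "t \<noteq> conj_deriv (slope lam z)"
    moreover have "t \<in> I" using min by (simp add: is_arg_min_def)
    ultimately have
      "scalar_obj \<psi> \<alpha> l p lam z (conj_deriv (slope lam z)) < scalar_obj \<psi> \<alpha> l p lam z t"
      using conj_deriv_strict_min[of t "slope lam z"] alpha_pos
      by (simp add: scalar_obj_eq[OF assms] conj_deriv_in_I)
    then show False using min conj_deriv_in_I by (auto simp: is_arg_min_def)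
  qed
next
  assume "t = conj_deriv (slope lam z)"
  then show "is_arg_min (scalar_obj \<psi> \<alpha> l p lam z) (\<lambda>t. t \<in> I) t"
    using conj_deriv_min[of _ "slope lam z"] alpha_pos
    by (auto simp: is_arg_min_def scalar_obj_eq[OF assms] conj_deriv_in_I not_less)
qed

abbreviation q_star :: "real \<Rightarrow> 'a \<Rightarrow> real" where
  "q_star \<equiv> q_dual I \<psi> \<alpha> l p"

text \<open>\<open>arg_min_on\<close> is a choice operator; uniqueness of the minimizer leaves it a
  single candidate.\<close>

lemma q_dual_eq:
  assumes "z \<in> space M" "l z \<noteq> \<infinity>"
  shows "q_star lam z = conj_deriv (slope lam z)"
  unfolding q_dual_def arg_min_on_def arg_min_def is_arg_min_scalar_obj_iff[OF assms] by simp

text \<open>Where \<open>l\<close> is infinite the scalar objective does not depend on the point, so the choice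
  made by \<^const>\<open>arg_min_on\<close> is constant there, whatever it is.\<close>

lemma q_dual_measurable [measurable]: "q_star lam \<in> borel_measurable M"
proof -
  define c where "c = arg_min_on (\<lambda>t. ereal \<alpha> * \<psi> t + \<infinity> * ereal t) I"
  have "q_star lam z = c" if "l z = \<infinity>" for z
    using that unfolding q_dual_def c_def scalar_obj_def by simp
  then have "q_star lam \<in> borel_measurable M \<longleftrightarrow>
      (\<lambda>z. if l z = \<infinity> then c else conj_deriv (slope lam z)) \<in> borel_measurable M"
    by (intro measurable_cong) (auto simp: q_dual_eq)
  then show ?thesis by simp
qed

lemma AE_q_dual_eq: "AE z in M. q_star lam z = conj_deriv (slope lam z)"
  using l_finite AE_space by eventually_elim (rule q_dual_eq)

lemma AE_q_dual_in_I: "AE z in M. q_star lam z \<in> I"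
  using AE_q_dual_eq[of lam] by eventually_elim (simp add: conj_deriv_in_I)

lemma q_dual_formula:
  assumes "z \<in> space M" "l z \<noteq> \<infinity>"
  shows "q_star lam z =
    (if ereal (slope lam z) \<le> psi_deriv0 \<psi> then 0 else psi_deriv_inv \<psi> (slope lam z))"
  unfolding q_dual_eq[OF assms] conj_deriv_def ..

text \<open>\<open>red\<close>, \<open>breg\<close> and \<open>offset\<close> are total real
  representatives of the extended-valued integrands. They agree with them almost everywhere when
  \<open>p\<close> and \<open>q\<close> take values in \<open>I\<close>, and are Borel measurable
  without any condition on \<psi> at negative arguments.\<close>

definition red :: "('a \<Rightarrow> real) \<Rightarrow> 'a \<Rightarrow> real" where
  "red q z = \<alpha> * \<phi> (max 0 (q z)) + (L z - \<alpha> * psi_deriv \<psi> (p z)) * q z"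

definition breg :: "('a \<Rightarrow> real) \<Rightarrow> 'a \<Rightarrow> real" where
  "breg q z = \<phi> (max 0 (q z)) - \<phi> (max 0 (p z)) - psi_deriv \<psi> (p z) * (q z - p z)"

definition offset :: "'a \<Rightarrow> real" where
  "offset z = psi_deriv \<psi> (p z) * p z - \<phi> (max 0 (p z))"

lemma phi_max_measurable [measurable]:
  assumes [measurable]: "q \<in> borel_measurable M"
  shows "(\<lambda>z. \<phi> (max 0 (q z))) \<in> borel_measurable M"
  using measurable_compose[OF assms borel_measurable_phi_max] .

lemma red_measurable [measurable]:
  assumes [measurable]: "q \<in> borel_measurable M"
  shows "red q \<in> borel_measurable M"
  unfolding red_def by measurable

lemma breg_measurable [measurable]:
  assumes [measurable]: "q \<in> borel_measurable M"
  shows "breg q \<in> borel_measurable M"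
  unfolding breg_def by measurable

lemma offset_measurable [measurable]: "offset \<in> borel_measurable M"
  unfolding offset_def by measurable

text \<open>The pointwise link between the two problems: the integrand of the original objective
  differs from the reduced one by a term independent of \<open>q\<close>.\<close>

lemma red_eq: "red q z = L z * q z + \<alpha> * breg q z - \<alpha> * offset z"
  by (simp add: red_def breg_def offset_def algebra_simps)

lemma psi_eq_phi_max: "t \<in> I \<Longrightarrow> \<psi> t = ereal (\<phi> (max 0 t))"
  using psi_eq_phi[of t] in_I_nonneg[of t] by (simp add: max_def)

lemma AE_reduced_integrand:
  assumes "AE z in M. q z \<in> I"
  shows "AE z in M. reduced_integrand \<psi> \<alpha> l p q z = ereal (red q z)"
  using assms AE_l_eq_L
  by eventually_elim (simp add: reduced_integrand_def red_def psi_eq_phi_max)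

lemma AE_bregman_integrand:
  assumes "AE z in M. q z \<in> I" "AE z in M. p' z = p z"
  shows "AE z in M. bregman_integrand \<psi> q p' z = ereal (breg q z)"
  using assms p_in_I
  by eventually_elim (simp add: bregman_integrand_def breg_def psi_eq_phi_max)

lemma AE_offset: "AE z in M. ereal (psi_deriv \<psi> (p z) * p z) - \<psi> (p z) = ereal (offset z)"
  using p_in_I by eventually_elim (simp add: offset_def psi_eq_phi_max)

lemma AE_breg_nonneg:
  assumes "AE z in M. q z \<in> I"
  shows "AE z in M. 0 \<le> breg q z"
  using assms p_in_I
proof eventually_elim
  case (elim z)
  then show ?case
    using bregman_nonneg[of "p z" "q z"] in_I_nonneg[of "p z"] in_I_nonneg[of "q z"]
    by (simp add: breg_def max_def)
qed

text \<open>The excess of the Lagrangian integrand, with multiplier \<open>lam\<close> for the mass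
  constraint, over its value at the candidate.\<close>

definition gap :: "real \<Rightarrow> ('a \<Rightarrow> real) \<Rightarrow> 'a \<Rightarrow> real" where
  "gap lam q z = red q z + lam * q z - (red (q_star lam) z + lam * q_star lam z)"

lemma gap_measurable [measurable]:
  assumes [measurable]: "q \<in> borel_measurable M"
  shows "gap lam q \<in> borel_measurable M"
  unfolding gap_def by measurable

text \<open>With the multiplier term included, the integrand becomes \<alpha> times \<phi> t - y t
  at \<open>y = slope lam z\<close> and \<open>t = q z\<close>, up to a rearrangement. Pointwise
  strict minimality of \<open>conj_deriv\<close> then gives both claims.\<close>

lemma AE_gap:
  assumes "AE z in M. q z \<in> I"
  shows "AE z in M. 0 \<le> gap lam q z \<and> (gap lam q z = 0 \<longrightarrow> q z = q_star lam z)"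
  using assms AE_q_dual_eq[of lam]
proof eventually_elim
  case (elim z)
  let ?x = "conj_deriv (slope lam z)" and ?y = "slope lam z"
  have "\<alpha> * ?y = \<alpha> * psi_deriv \<psi> (p z) - L z - lam"
    using alpha_pos by (simp add: slope_def field_simps)
  then have "L z - \<alpha> * psi_deriv \<psi> (p z) + lam = - (\<alpha> * ?y)" by linarith
  then have lin: "(L z - \<alpha> * psi_deriv \<psi> (p z)) * t + lam * t = - (\<alpha> * ?y * t)" for t
    by (metis distrib_right minus_mult_left)
  have "gap lam q z = \<alpha> * ((\<phi> (q z) - ?y * q z) - (\<phi> ?x - ?y * ?x))"
    using in_I_nonneg[OF elim(1)] in_I_nonneg[OF conj_deriv_in_I[of ?y]] lin[of "q z"] lin[of ?x]
    by (simp add: gap_def red_def elim(2) max_absorb2 right_diff_distrib mult.assoc)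
  moreover have "0 \<le> (\<phi> (q z) - ?y * q z) - (\<phi> ?x - ?y * ?x)"
    using conj_deriv_min[OF elim(1), of ?y] by simp
  moreover have "(\<phi> (q z) - ?y * q z) - (\<phi> ?x - ?y * ?x) \<noteq> 0" if "q z \<noteq> ?x"
    using conj_deriv_strict_min[OF elim(1) that] by simp
  ultimately show ?case
    unfolding elim(2) using alpha_pos by (metis mult_eq_0_iff mult_nonneg_nonneg less_imp_le less_irrefl)
qed

section \<open>Optimality and uniqueness in the reduced problem\<close>

context
  fixes lam :: real
  assumes q_star_integral: "has_bochner_integral M (q_star lam) 1"
    and q_star_finite: "ext_integral_finite M (reduced_integrand \<psi> \<alpha> l p (q_star lam))"
begin

lemma q_star_feasible: "q_star lam \<in> reduced_feasible M I"
  using q_star_integral AE_q_dual_in_I by (simp add: reduced_feasible_def)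

lemma integrable_red_q_star: "integrable M (red (q_star lam))"
  using AE_reduced_integrand[OF AE_q_dual_in_I] q_star_finite
  by (intro integrable_if_ext_integral_finite) auto

text \<open>Definedness, minimality and uniqueness all follow from this formula, with no finiteness
  assumed at \<open>q\<close>: the last integral is nonnegative and vanishes only if
  \<open>gap\<close> does almost everywhere.\<close>

lemma reduced_obj_eq:
  assumes "q \<in> reduced_feasible M I"
  shows "ext_integral_defined M (reduced_integrand \<psi> \<alpha> l p q)"
    and "reduced_obj M \<psi> \<alpha> l p q =
      ereal (\<integral>z. red (q_star lam) z \<partial>M) + enn2ereal (\<integral>\<^sup>+ z. ennreal (gap lam q z) \<partial>M)"
proof -
  have [measurable]: "q \<in> borel_measurable M" and q_I: "AE z in M. q z \<in> I"
    and q: "has_bochner_integral M q 1"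
    using assms by (auto simp: reduced_feasible_def)
  \<comment> \<open>This is \<open>red q\<close> minus \<open>gap lam q\<close>. Both densities have
    mass one, so the multiplier term integrates to zero.\<close>
  let ?u = "\<lambda>z. red (q_star lam) z + lam * (q_star lam z - q z)"
  have int: "has_bochner_integral M ?u ((\<integral>z. red (q_star lam) z \<partial>M) + lam * (1 - 1))"
    using integrable_red_q_star q_star_integral q
    by (intro has_bochner_integral_add has_bochner_integral_mult_right has_bochner_integral_diff)
      (auto simp: has_bochner_integral_iff)
  have u: "integrable M ?u" and u_int: "(\<integral>z. ?u z \<partial>M) = (\<integral>z. red (q_star lam) z \<partial>M)"
    using int unfolding has_bochner_integral_iff by auto
  have nonneg: "AE z in M. 0 \<le> gap lam q z"
    using AE_gap[OF q_I, of lam] by eventually_elim simp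
  have eq: "AE z in M. reduced_integrand \<psi> \<alpha> l p q z = ereal (?u z + gap lam q z)"
    using AE_reduced_integrand[OF q_I] by eventually_elim (simp add: gap_def algebra_simps)
  show "ext_integral_defined M (reduced_integrand \<psi> \<alpha> l p q)"
    by (rule ext_integral_integrable_plus_nonneg(1)[OF u _ nonneg eq]) measurable
  have "reduced_obj M \<psi> \<alpha> l p q = ereal (\<integral>z. ?u z \<partial>M) + enn2ereal (\<integral>\<^sup>+ z. ennreal (gap lam q z) \<partial>M)"
    unfolding reduced_obj_def
    by (rule ext_integral_integrable_plus_nonneg(2)[OF u _ nonneg eq]) measurable
  then show "reduced_obj M \<psi> \<alpha> l p q =
      ereal (\<integral>z. red (q_star lam) z \<partial>M) + enn2ereal (\<integral>\<^sup>+ z. ennreal (gap lam q z) \<partial>M)"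
    unfolding u_int .
qed

lemma reduced_obj_q_star: "reduced_obj M \<psi> \<alpha> l p (q_star lam) = ereal (\<integral>z. red (q_star lam) z \<partial>M)"
  using reduced_obj_eq(2)[OF q_star_feasible] by (simp add: gap_def zero_ennreal.rep_eq)

lemma reduced_obj_q_star_le:
  assumes "q \<in> reduced_feasible M I"
  shows "reduced_obj M \<psi> \<alpha> l p (q_star lam) \<le> reduced_obj M \<psi> \<alpha> l p q"
  unfolding reduced_obj_q_star reduced_obj_eq(2)[OF assms]
  using enn2ereal_nonneg by (intro ereal_le_add_self) auto

text \<open>Stated for an inequality of values, so that uniqueness in the original problem can use
  it as well. The value at the candidate is finite and cancels, leaving \<open>gap\<close> with
  integral zero.\<close>

lemma AE_eq_q_star:
  assumes q: "q \<in> reduced_feasible M I"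
    and le: "reduced_obj M \<psi> \<alpha> l p q \<le> reduced_obj M \<psi> \<alpha> l p (q_star lam)"
  shows "AE z in M. q z = q_star lam z"
proof -
  have [measurable]: "q \<in> borel_measurable M" and q_I: "AE z in M. q z \<in> I"
    using q by (auto simp: reduced_feasible_def)
  have "enn2ereal (\<integral>\<^sup>+ z. ennreal (gap lam q z) \<partial>M) \<le> 0"
    using le unfolding reduced_obj_q_star reduced_obj_eq(2)[OF q]
    by (cases "enn2ereal (\<integral>\<^sup>+ z. ennreal (gap lam q z) \<partial>M)") auto
  then have "(\<integral>\<^sup>+ z. ennreal (gap lam q z) \<partial>M) = 0"
    by (metis enn2ereal_nonneg antisym enn2ereal_inject zero_ennreal.rep_eq)
  then have "AE z in M. ennreal (gap lam q z) = 0"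
    by (subst (asm) nn_integral_0_iff_AE) measurable
  with AE_gap[OF q_I, of lam] show ?thesis
    by eventually_elim (auto simp: ennreal_eq_0_iff)
qed

lemma is_arg_min_reduced_obj:
  "is_arg_min (reduced_obj M \<psi> \<alpha> l p) (\<lambda>q. q \<in> reduced_feasible M I) (q_star lam)"
  using q_star_feasible reduced_obj_q_star_le by (auto simp: is_arg_min_def not_less)

lemma is_arg_min_reduced_obj_unique:
  "is_arg_min (reduced_obj M \<psi> \<alpha> l p) (\<lambda>q. q \<in> reduced_feasible M I) q \<Longrightarrow>
    AE z in M. q z = q_star lam z"
  using q_star_feasible by (intro AE_eq_q_star) (auto simp: is_arg_min_def not_less)

end

section \<open>Passage between feasible densities and feasible measures\<close>

lemma rn_dens_measurable [measurable]: "rn_dens M Q \<in> borel_measurable M"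
  unfolding rn_dens_def by measurable

lemma rn_dens_density:
  assumes [measurable]: "q \<in> borel_measurable M" and "AE z in M. 0 \<le> q z"
  shows "AE z in M. rn_dens M (density M (\<lambda>z. ennreal (q z))) z = q z"
proof -
  have "AE z in M. ennreal (q z) = RN_deriv M (density M (\<lambda>z. ennreal (q z))) z"
    by (rule RN_deriv_unique) auto
  with assms(2) show ?thesis
    by eventually_elim (metis enn2real_ennreal rn_dens_def)
qed

text \<open>\<open>enn2real\<close> sends \<infinity> to 0, but the Radon-Nikodym derivative of a
  finite measure is finite almost everywhere, so no mass is lost.\<close>

lemma density_rn_dens:
  assumes "prob_space Q" "sets Q = sets M" "absolutely_continuous M Q"
  shows "density M (\<lambda>z. ennreal (rn_dens M Q z)) = Q"
proof -
  interpret Q: prob_space Q by fact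
  have "AE z in M. RN_deriv M Q z \<noteq> \<infinity>"
    using assms Q.sigma_finite_measure_axioms by (intro RN_deriv_finite)
  then have "AE z in M. ennreal (rn_dens M Q z) = RN_deriv M Q z"
    by eventually_elim (simp add: rn_dens_def less_top[symmetric])
  then have "density M (\<lambda>z. ennreal (rn_dens M Q z)) = density M (RN_deriv M Q)"
    by (intro density_cong) auto
  also have "\<dots> = Q" using assms by (intro density_RN_deriv)
  finally show ?thesis .
qed

lemma rn_dens_feasible:
  assumes "Q \<in> orig_feasible M I"
  shows "rn_dens M Q \<in> reduced_feasible M I"
proof -
  have Q: "prob_space Q" "sets Q = sets M" "absolutely_continuous M Q" "AE z in M. rn_dens M Q z \<in> I"
    using assms by (auto simp: orig_feasible_def)
  interpret Q: prob_space Q by fact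
  have "(\<integral>\<^sup>+ z. ennreal (rn_dens M Q z) \<partial>M) = emeasure (density M (\<lambda>z. ennreal (rn_dens M Q z))) (space M)"
    by (subst emeasure_density) (auto intro!: nn_integral_cong)
  also have "\<dots> = 1"
    using Q.emeasure_space_1 sets_eq_imp_space_eq[OF Q(2)] by (simp add: density_rn_dens[OF Q(1-3)])
  finally have "has_bochner_integral M (rn_dens M Q) 1"
    by (intro has_bochner_integral_nn_integral) (auto simp: rn_dens_def)
  then show ?thesis using Q by (simp add: reduced_feasible_def)
qed

lemma density_feasible:
  assumes "q \<in> reduced_feasible M I"
  shows "density M (\<lambda>z. ennreal (q z)) \<in> orig_feasible M I"
proof -
  have [measurable]: "q \<in> borel_measurable M" and q_I: "AE z in M. q z \<in> I"
    and q: "has_bochner_integral M q 1"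
    using assms by (auto simp: reduced_feasible_def)
  have nonneg: "AE z in M. 0 \<le> q z"
    using q_I by eventually_elim (rule in_I_nonneg)
  have "(\<integral>\<^sup>+ z. ennreal (q z) \<partial>M) = ennreal 1"
    using q nonneg by (subst nn_integral_eq_integral) (auto simp: has_bochner_integral_iff)
  moreover have "emeasure (density M (\<lambda>z. ennreal (q z))) (space M) = (\<integral>\<^sup>+ z. ennreal (q z) \<partial>M)"
    by (subst emeasure_density) (auto intro!: nn_integral_cong)
  ultimately have "prob_space (density M (\<lambda>z. ennreal (q z)))"
    by (intro prob_spaceI) simp
  moreover have "AE z in M. rn_dens M (density M (\<lambda>z. ennreal (q z))) z \<in> I"
    using rn_dens_density[OF \<open>q \<in> borel_measurable M\<close> nonneg] q_I by eventually_elim simp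
  ultimately show ?thesis
    by (auto simp: orig_feasible_def intro!: absolutely_continuousI_density)
qed

text \<open>Needed because passing from a density to its measure and back recovers the density only
  almost everywhere.\<close>

lemma reduced_obj_cong_AE:
  assumes "AE z in M. q z = q' z"
  shows "reduced_obj M \<psi> \<alpha> l p q = reduced_obj M \<psi> \<alpha> l p q'"
proof -
  have "(\<integral>\<^sup>+ z. e2ennreal (reduced_integrand \<psi> \<alpha> l p q z) \<partial>M) =
      (\<integral>\<^sup>+ z. e2ennreal (reduced_integrand \<psi> \<alpha> l p q' z) \<partial>M)"
    "(\<integral>\<^sup>+ z. e2ennreal (- reduced_integrand \<psi> \<alpha> l p q z) \<partial>M) =
      (\<integral>\<^sup>+ z. e2ennreal (- reduced_integrand \<psi> \<alpha> l p q' z) \<partial>M)"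
    using assms by (auto intro!: nn_integral_cong_AE elim!: eventually_mono simp: reduced_integrand_def)
  then show ?thesis by (simp add: reduced_obj_def ext_integral_def)
qed

section \<open>The original objective as a shift of the reduced one\<close>

context
  fixes P :: "'a measure"
  assumes P_eq: "P = density M (\<lambda>z. ennreal (p z))"
    and offset_finite: "ext_integral_finite M (\<lambda>z. ereal (psi_deriv \<psi> (p z) * p z) - \<psi> (p z))"
begin

lemma integrable_offset: "integrable M offset"
  using AE_offset offset_finite by (intro integrable_if_ext_integral_finite) auto

text \<open>The expected loss and the divergence may each be infinite, but neither can be
  -\<infinity>, so their sum can be assembled before the finite constant is moved across.\<close>

lemma orig_obj_eq:
  assumes "Q \<in> orig_feasible M I"
  shows "ext_integral_defined Q l"
    and "ext_integral_defined M (bregman_integrand \<psi> (rn_dens M Q) (rn_dens M P))"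
    and "orig_obj M \<psi> \<alpha> l P Q =
      reduced_obj M \<psi> \<alpha> l p (rn_dens M Q) + ereal (\<alpha> * (\<integral>z. offset z \<partial>M))"
proof -
  let ?q = "rn_dens M Q"
  have Q: "prob_space Q" "sets Q = sets M" "absolutely_continuous M Q" and q_I: "AE z in M. ?q z \<in> I"
    using assms by (auto simp: orig_feasible_def)
  interpret Q: prob_space Q by fact
  have [measurable_cong]: "sets Q = sets M" by fact
  have q: "has_bochner_integral M ?q 1"
    using rn_dens_feasible[OF assms] by (simp add: reduced_feasible_def)
  have q_nonneg: "0 \<le> ?q z" for z by (simp add: rn_dens_def)
  have p_eq: "AE z in M. rn_dens M P z = p z"
    unfolding P_eq using p_in_I by (intro rn_dens_density) (auto elim!: eventually_mono dest: in_I_nonneg)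

  have AE_Q: "AE z in Q. R z" if "AE z in M. R z" for R
    using that by (rule absolutely_continuous_AE[OF Q(2,3)])
  \<comment> \<open>The constant \<open>b\<close> is integrable because \<open>Q\<close> is a
    probability measure, and \<open>L z - b\<close> is nonnegative almost everywhere.\<close>
  have l_Q: "AE z in Q. l z = ereal (b + (L z - b))"
    using AE_Q[OF AE_l_eq_L] by eventually_elim simp
  have L_Q: "AE z in Q. 0 \<le> L z - b"
    using AE_Q[OF AE_L_ge] by eventually_elim simp
  have b_Q: "integrable Q (\<lambda>_. b)" by simp
  show "ext_integral_defined Q l"
    by (rule ext_integral_integrable_plus_nonneg(1)[OF b_Q _ L_Q l_Q]) measurable
  have "ext_integral Q l = ereal (\<integral>z. b \<partial>Q) + enn2ereal (\<integral>\<^sup>+ z. ennreal (L z - b) \<partial>Q)"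
    by (rule ext_integral_integrable_plus_nonneg(2)[OF b_Q _ L_Q l_Q]) measurable
  moreover have "(\<integral>\<^sup>+ z. ennreal (L z - b) \<partial>Q) = (\<integral>\<^sup>+ z. ennreal (?q z * (L z - b)) \<partial>M)"
    by (subst density_rn_dens[OF Q, symmetric], subst nn_integral_density)
      (auto simp: ennreal_mult' q_nonneg)
  ultimately have l_int:
    "ext_integral Q l = ereal b + enn2ereal (\<integral>\<^sup>+ z. ennreal (?q z * (L z - b)) \<partial>M)"
    by (simp add: Q.prob_space)

  have breg_eq: "AE z in M. bregman_integrand \<psi> ?q (rn_dens M P) z = ereal (0 + breg ?q z)"
    using AE_bregman_integrand[OF q_I p_eq] by simp
  have zero: "integrable M (\<lambda>_. 0 :: real)" by simp
  show "ext_integral_defined M (bregman_integrand \<psi> ?q (rn_dens M P))"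
    by (rule ext_integral_integrable_plus_nonneg(1)[OF zero _ AE_breg_nonneg[OF q_I] breg_eq]) measurable
  have "bregman_div M \<psi> Q P = ereal (\<integral>z. 0 \<partial>M) + enn2ereal (\<integral>\<^sup>+ z. ennreal (breg ?q z) \<partial>M)"
    unfolding bregman_div_def
    by (rule ext_integral_integrable_plus_nonneg(2)[OF zero _ AE_breg_nonneg[OF q_I] breg_eq]) measurable
  then have D: "bregman_div M \<psi> Q P = enn2ereal (\<integral>\<^sup>+ z. ennreal (breg ?q z) \<partial>M)"
    by (simp flip: zero_ereal_def)

  \<comment> \<open>By \<open>red_eq\<close> the two add up to \<open>red\<close>. The nonnegative
    part \<open>?v\<close> collects exactly the integrands already computed for the loss and the
    divergence; \<open>?u\<close> holds the finite remainder.\<close>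
  let ?u = "\<lambda>z. b * ?q z - \<alpha> * offset z" and ?v = "\<lambda>z. ?q z * (L z - b) + \<alpha> * breg ?q z"
  have "has_bochner_integral M ?u (b * 1 - \<alpha> * (\<integral>z. offset z \<partial>M))"
    using integrable_offset q
    by (intro has_bochner_integral_diff has_bochner_integral_mult_right) (auto simp: has_bochner_integral_iff)
  then have u: "integrable M ?u" and u_int: "(\<integral>z. ?u z \<partial>M) = b - \<alpha> * (\<integral>z. offset z \<partial>M)"
    unfolding has_bochner_integral_iff by auto
  have v_nonneg: "AE z in M. 0 \<le> ?v z"
    using AE_breg_nonneg[OF q_I] AE_L_ge
    by eventually_elim (use alpha_pos q_nonneg in \<open>auto intro!: add_nonneg_nonneg\<close>)
  have red: "AE z in M. reduced_integrand \<psi> \<alpha> l p ?q z = ereal (?u z + ?v z)"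
    using AE_reduced_integrand[OF q_I] by eventually_elim (simp add: red_eq algebra_simps)
  have "reduced_obj M \<psi> \<alpha> l p ?q = ereal (\<integral>z. ?u z \<partial>M) + enn2ereal (\<integral>\<^sup>+ z. ennreal (?v z) \<partial>M)"
    unfolding reduced_obj_def
    by (rule ext_integral_integrable_plus_nonneg(2)[OF u _ v_nonneg red]) measurable
  moreover have "(\<integral>\<^sup>+ z. ennreal (?v z) \<partial>M) =
      (\<integral>\<^sup>+ z. ennreal (?q z * (L z - b)) + ennreal \<alpha> * ennreal (breg ?q z) \<partial>M)"
    using AE_breg_nonneg[OF q_I] AE_L_ge
  proof (intro nn_integral_cong_AE, eventually_elim)
    case (elim z)
    then show ?case using alpha_pos q_nonneg by (simp add: ennreal_mult')
  qed
  moreover have "\<dots> = (\<integral>\<^sup>+ z. ennreal (?q z * (L z - b)) \<partial>M) + ennreal \<alpha> * (\<integral>\<^sup>+ z. ennreal (breg ?q z) \<partial>M)"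
    by (simp add: nn_integral_add nn_integral_cmult)
  ultimately have R: "reduced_obj M \<psi> \<alpha> l p ?q = ereal (b - \<alpha> * (\<integral>z. offset z \<partial>M)) +
      (enn2ereal (\<integral>\<^sup>+ z. ennreal (?q z * (L z - b)) \<partial>M) +
       ereal \<alpha> * enn2ereal (\<integral>\<^sup>+ z. ennreal (breg ?q z) \<partial>M))"
    using alpha_pos by (simp add: u_int plus_ennreal.rep_eq times_ennreal.rep_eq enn2ereal_ennreal)
  \<comment> \<open>Nonnegativity of \<open>a\<close> and \<open>c\<close> keeps \<infinity> -
    \<infinity> from arising when \<open>y\<close> is subtracted and added back.\<close>
  have shift: "ereal x + a + c = ereal (x - y) + (a + c) + ereal y" if "0 \<le> a" "0 \<le> c" for x y a c
    using that by (cases a; cases c) auto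
  show "orig_obj M \<psi> \<alpha> l P Q =
      reduced_obj M \<psi> \<alpha> l p ?q + ereal (\<alpha> * (\<integral>z. offset z \<partial>M))"
    unfolding orig_obj_def l_int D R using alpha_pos by (intro shift) auto
qed

context
  fixes lam :: real
  assumes q_star_integral: "has_bochner_integral M (q_star lam) 1"
    and q_star_finite: "ext_integral_finite M (reduced_integrand \<psi> \<alpha> l p (q_star lam))"
begin

abbreviation (input) Q_star :: "'a measure" where
  "Q_star \<equiv> density M (\<lambda>z. ennreal (q_star lam z))"

lemma Q_star_feasible: "Q_star \<in> orig_feasible M I"
  by (rule density_feasible[OF q_star_feasible[OF q_star_integral q_star_finite]])

lemma orig_obj_Q_star:
  "orig_obj M \<psi> \<alpha> l P Q_star =
    reduced_obj M \<psi> \<alpha> l p (q_star lam) + ereal (\<alpha> * (\<integral>z. offset z \<partial>M))"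
proof -
  have "AE z in M. rn_dens M Q_star z = q_star lam z"
    using AE_q_dual_in_I[of lam] by (intro rn_dens_density) (auto elim!: eventually_mono dest: in_I_nonneg)
  from reduced_obj_cong_AE[OF this] show ?thesis
    using orig_obj_eq(3)[OF Q_star_feasible] by simp
qed

lemma is_arg_min_orig_obj:
  "is_arg_min (orig_obj M \<psi> \<alpha> l P) (\<lambda>Q. Q \<in> orig_feasible M I) Q_star"
  using reduced_obj_q_star_le[OF q_star_integral q_star_finite rn_dens_feasible]
  by (auto simp: is_arg_min_def not_less Q_star_feasible orig_obj_Q_star orig_obj_eq(3) intro!: add_right_mono)

text \<open>The common constant is finite and cancels, which reduces the claim to
  \<open>AE_eq_q_star\<close>. Densities equal almost everywhere define the same measure, so here
  uniqueness is an equality.\<close>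

lemma is_arg_min_orig_obj_unique:
  assumes "is_arg_min (orig_obj M \<psi> \<alpha> l P) (\<lambda>Q. Q \<in> orig_feasible M I) Q"
  shows "Q = Q_star"
proof -
  have Q: "Q \<in> orig_feasible M I" and "orig_obj M \<psi> \<alpha> l P Q \<le> orig_obj M \<psi> \<alpha> l P Q_star"
    using assms Q_star_feasible by (auto simp: is_arg_min_def not_less)
  then have "reduced_obj M \<psi> \<alpha> l p (rn_dens M Q) + ereal (\<alpha> * (\<integral>z. offset z \<partial>M)) \<le>
      reduced_obj M \<psi> \<alpha> l p (q_star lam) + ereal (\<alpha> * (\<integral>z. offset z \<partial>M))"
    by (simp add: orig_obj_Q_star orig_obj_eq(3))
  then have "reduced_obj M \<psi> \<alpha> l p (rn_dens M Q) \<le> reduced_obj M \<psi> \<alpha> l p (q_star lam)"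
    by (simp add: ereal_add_le_add_iff2)
  then have "AE z in M. rn_dens M Q z = q_star lam z"
    by (rule AE_eq_q_star[OF q_star_integral q_star_finite rn_dens_feasible[OF Q]])
  then have "density M (\<lambda>z. ennreal (rn_dens M Q z)) = Q_star"
    by (intro density_cong) (auto elim!: eventually_mono)
  then show ?thesis
    using Q by (simp add: density_rn_dens orig_feasible_def)
qed

end

end

end

theorem theorem3:
  fixes M P :: "'a measure"
    and p :: "'a \<Rightarrow> real"
    and \<alpha> :: real
    and l :: "'a \<Rightarrow> ereal"
    and I :: "real set"
    and \<psi> :: "real \<Rightarrow> ereal"
  assumes "sigma_finite_measure M"
    and "prob_space P"
    and "sets P = sets M"
    and "absolutely_continuous M P"
    and "p \<in> borel_measurable M"
    and "AE z in M. 0 \<le> p z"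
    and "P = density M (\<lambda>z. ennreal (p z))"
    and "\<alpha> > 0"
    and "l \<in> borel_measurable M"
    and "\<forall>z\<in>space M. l z \<noteq> - \<infinity>"
    and "(\<integral>\<^sup>+ z. e2ennreal \<bar>l z\<bar> \<partial>P) < \<infinity>"
    and "AE z in M. l z \<noteq> \<infinity>"
    and "\<exists>b::real. AE z in M. ereal b \<le> l z"
    and "I = {0..} \<or> I = {0<..}"
    and "proper_on I \<psi>"
    and "lsc_on I \<psi>"
    and "strictly_convex_on I \<psi>"
    and "differentiable_pos \<psi>"
    and "filterlim (psi_deriv \<psi>) at_top at_top"
    and "I = {0<..} \<Longrightarrow> (AE z in M. 0 < p z) \<and> psi_deriv0 \<psi> = - \<infinity>"
    and "I = {0..} \<Longrightarrow> psi_deriv0 \<psi> > - \<infinity>"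
  shows
    "bij_betw (psi_deriv \<psi>) {0<..} {y. psi_deriv0 \<psi> < ereal y} \<and>
     (\<forall>lam::real.
        (\<forall>z\<in>space M. l z \<noteq> \<infinity> \<longrightarrow>
           (\<exists>!t. is_arg_min (scalar_obj \<psi> \<alpha> l p lam z) (\<lambda>t. t \<in> I) t)) \<and>
        q_dual I \<psi> \<alpha> l p lam \<in> borel_measurable M \<and>
        (\<forall>z\<in>space M. l z \<noteq> \<infinity> \<longrightarrow>
           (let y = psi_deriv \<psi> (p z) - (real_of_ereal (l z) + lam) / \<alpha> in
              (q_dual I \<psi> \<alpha> l p lam z \<in> {0<..} \<longrightarrow>
                 psi_deriv0 \<psi> < ereal y \<and>
                 q_dual I \<psi> \<alpha> l p lam z = psi_deriv_inv \<psi> y) \<and>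
              (I = {0..} \<longrightarrow>
                 q_dual I \<psi> \<alpha> l p lam z =
                   (if ereal y \<le> psi_deriv0 \<psi> then 0 else psi_deriv_inv \<psi> y))))) \<and>
     (\<forall>lam::real.
        has_bochner_integral M (q_dual I \<psi> \<alpha> l p lam) 1 \<and>
        ext_integral_finite M (reduced_integrand \<psi> \<alpha> l p (q_dual I \<psi> \<alpha> l p lam)) \<longrightarrow>
          (\<forall>q\<in>reduced_feasible M I.
             ext_integral_defined M (reduced_integrand \<psi> \<alpha> l p q)) \<and>
          is_arg_min (reduced_obj M \<psi> \<alpha> l p) (\<lambda>q. q \<in> reduced_feasible M I)
            (q_dual I \<psi> \<alpha> l p lam) \<and>
          (\<forall>q. is_arg_min (reduced_obj M \<psi> \<alpha> l p) (\<lambda>q. q \<in> reduced_feasible M I) q \<longrightarrow>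
             (AE z in M. q z = q_dual I \<psi> \<alpha> l p lam z)) \<and>
          (ext_integral_finite M (\<lambda>z. ereal (psi_deriv \<psi> (p z) * p z) - \<psi> (p z)) \<longrightarrow>
             (\<forall>Q\<in>orig_feasible M I.
                ext_integral_defined Q l \<and>
                ext_integral_defined M
                  (bregman_integrand \<psi> (rn_dens M Q) (rn_dens M P))) \<and>
             is_arg_min (orig_obj M \<psi> \<alpha> l P) (\<lambda>Q. Q \<in> orig_feasible M I)
               (density M (\<lambda>z. ennreal (q_dual I \<psi> \<alpha> l p lam z))) \<and>
             (\<forall>Q. is_arg_min (orig_obj M \<psi> \<alpha> l P) (\<lambda>Q. Q \<in> orig_feasible M I) Q \<longrightarrow>
                Q = density M (\<lambda>z. ennreal (q_dual I \<psi> \<alpha> l p lam z)))))"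
proof -
  obtain b where b: "AE z in M. ereal b \<le> l z"
    using assms(13) by blast
  have p_I: "AE z in M. p z \<in> I"
    using assms(14)
  proof
    assume "I = {0..}"
    then show ?thesis using assms(6) by simp
  next
    assume "I = {0<..}"
    then show ?thesis using assms(20) by simp
  qed
  interpret sigma_finite_measure M by fact
  interpret bregman_problem I \<psi> M p \<alpha> l b
    using assms b p_I by unfold_locales auto
  \<comment> \<open>A positive minimizer excludes the branch with value 0, and failure of that
    branch's condition is precisely what puts \<open>y\<close> in the range of the derivative. The
    first formula thus holds for both forms of \<open>I\<close>.\<close>
  have formula: "let y = psi_deriv \<psi> (p z) - (real_of_ereal (l z) + lam) / \<alpha> in
      (q_dual I \<psi> \<alpha> l p lam z \<in> {0<..} \<longrightarrow>
        psi_deriv0 \<psi> < ereal y \<and> q_dual I \<psi> \<alpha> l p lam z = psi_deriv_inv \<psi> y) \<and>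
      (I = {0..} \<longrightarrow>
        q_dual I \<psi> \<alpha> l p lam z = (if ereal y \<le> psi_deriv0 \<psi> then 0 else psi_deriv_inv \<psi> y))"
    if "z \<in> space M" "l z \<noteq> \<infinity>" for z lam
    using q_dual_formula[OF that, of lam] unfolding slope_def L_def Let_def
    by (auto simp: not_le)
  show ?thesis
    by (intro conjI allI ballI impI; (elim conjE)?)
      (simp_all only: bij_psi_deriv is_arg_min_scalar_obj_iff q_dual_measurable formula
        reduced_obj_eq(1) is_arg_min_reduced_obj is_arg_min_reduced_obj_unique
        orig_obj_eq(1,2)[OF assms(7)] is_arg_min_orig_obj[OF assms(7)]
        ex1_eq is_arg_min_orig_obj_unique[OF assms(7)] simp_thms)
qed

end
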